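(* Let $p$ be a prime and let $G\le GL_d(p)=GL(V)$ be irreducible, $p$-exceptional and imprimitive, with $G=O^{p'}(G)$. Let $V=V_1\oplus\cdots\oplus V_n$ ($n>1$) be any decomposition of $V$ into nonzero subspaces permuted by $G$. Then the setwise stabiliser $G_{V_1}$ is transitive on $V_1^\sharp$, and the permutation group induced by $G$ on $\{V_1,\dots,V_n\}$ is a primitive $p$-concealed subgroup of $S_n$.
   Context: $V^\sharp$ denotes the set of nonzero vectors of $V$. $G\le GL_d(p)$ is $p$-exceptional if $p$ divides $|G|$ and every orbit of $G$ on $V=\mathbb{F}_p^d$ has size coprime to $p$. $K\le S_n$ is $p$-concealed if $p$ divides $|K|$ and every orbit of $K$ on the power set of $\{1,\dots,n\}$ has size coprime to $p$. $O^{p'}(G)$ is the smallest normal subgroup of $G$ of index coprime to $p$ (the subgroup generated by all $p$-elements). $G$ is imprimitive if it permutes the summands of some decomposition $V=V_1\oplus\cdots\oplus V_n$, $n>1$, into nonzero subspaces. *)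

theory Defs
  imports "HOL-Algebra.Algebra"
begin

definition vecs :: "nat \<Rightarrow> nat \<Rightarrow> (nat \<Rightarrow> nat) set" where
  "vecs p d = {v. (\<forall>i<d. v i < p) \<and> (\<forall>i\<ge>d. v i = 0)}"

definition vzero :: "nat \<Rightarrow> nat" where
  "vzero = (\<lambda>_. 0)"

definition vadd :: "nat \<Rightarrow> (nat \<Rightarrow> nat) \<Rightarrow> (nat \<Rightarrow> nat) \<Rightarrow> (nat \<Rightarrow> nat)" where
  "vadd p v w = (\<lambda>k. (v k + w k) mod p)"

definition vsmul :: "nat \<Rightarrow> nat \<Rightarrow> (nat \<Rightarrow> nat) \<Rightarrow> (nat \<Rightarrow> nat)" where
  "vsmul p c v = (\<lambda>k. (c * v k) mod p)"

definition vsum :: "nat \<Rightarrow> nat \<Rightarrow> (nat \<Rightarrow> nat \<Rightarrow> nat) \<Rightarrow> (nat \<Rightarrow> nat)" where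
  "vsum p n c = (\<lambda>k. (\<Sum>i<n. c i k) mod p)"

definition subspace_of :: "nat \<Rightarrow> nat \<Rightarrow> (nat \<Rightarrow> nat) set \<Rightarrow> bool" where
  "subspace_of p d W \<longleftrightarrow> W \<subseteq> vecs p d \<and> vzero \<in> W \<and>
     (\<forall>v\<in>W. \<forall>w\<in>W. vadd p v w \<in> W) \<and> (\<forall>c<p. \<forall>v\<in>W. vsmul p c v \<in> W)"

text \<open>GL_d(p): the invertible F_p-linear maps of V, as (extensional) permutations of V,
  so that GL_d(p) is a subgroup of the group BijGroup (vecs p d) of all permutations of V.\<close>
definition GL :: "nat \<Rightarrow> nat \<Rightarrow> ((nat \<Rightarrow> nat) \<Rightarrow> (nat \<Rightarrow> nat)) set" where
  "GL p d = {g \<in> Bij (vecs p d).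
      (\<forall>v\<in>vecs p d. \<forall>w\<in>vecs p d. g (vadd p v w) = vadd p (g v) (g w)) \<and>
      (\<forall>c<p. \<forall>v\<in>vecs p d. g (vsmul p c v) = vsmul p c (g v))}"

abbreviation grp :: "nat \<Rightarrow> nat \<Rightarrow> ((nat \<Rightarrow> nat) \<Rightarrow> (nat \<Rightarrow> nat)) set
   \<Rightarrow> ((nat \<Rightarrow> nat) \<Rightarrow> (nat \<Rightarrow> nat)) monoid" where
  "grp p d G \<equiv> (BijGroup (vecs p d))\<lparr>carrier := G\<rparr>"

definition irreducible_lin :: "nat \<Rightarrow> nat \<Rightarrow> ((nat \<Rightarrow> nat) \<Rightarrow> (nat \<Rightarrow> nat)) set \<Rightarrow> bool" where
  "irreducible_lin p d G \<longleftrightarrow>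
     (\<forall>W. subspace_of p d W \<and> (\<forall>g\<in>G. g ` W \<subseteq> W) \<longrightarrow> W = {vzero} \<or> W = vecs p d)"

definition orbit_vec :: "((nat \<Rightarrow> nat) \<Rightarrow> (nat \<Rightarrow> nat)) set \<Rightarrow> (nat \<Rightarrow> nat) \<Rightarrow> (nat \<Rightarrow> nat) set" where
  "orbit_vec G v = (\<lambda>g. g v) ` G"

definition p_exceptional :: "nat \<Rightarrow> nat \<Rightarrow> ((nat \<Rightarrow> nat) \<Rightarrow> (nat \<Rightarrow> nat)) set \<Rightarrow> bool" where
  "p_exceptional p d G \<longleftrightarrow> p dvd card G \<and> (\<forall>v\<in>vecs p d. coprime p (card (orbit_vec G v)))"

text \<open>O^{p'}(G): the smallest normal subgroup of G of index coprime to p, i.e. the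
  intersection of all normal subgroups of G of index coprime to p.\<close>
definition O_p' :: "nat \<Rightarrow> nat \<Rightarrow> ((nat \<Rightarrow> nat) \<Rightarrow> (nat \<Rightarrow> nat)) set
     \<Rightarrow> ((nat \<Rightarrow> nat) \<Rightarrow> (nat \<Rightarrow> nat)) set" where
  "O_p' p d G = \<Inter> {N. normal N (grp p d G) \<and> coprime p (card G div card N)}"

definition direct_decomp :: "nat \<Rightarrow> nat \<Rightarrow> nat \<Rightarrow> (nat \<Rightarrow> (nat \<Rightarrow> nat) set) \<Rightarrow> bool" where
  "direct_decomp p d n Vs \<longleftrightarrow>
     (\<forall>i<n. subspace_of p d (Vs i) \<and> Vs i \<noteq> {vzero}) \<and>
     (\<forall>v\<in>vecs p d. \<exists>c. (\<forall>i<n. c i \<in> Vs i) \<and> v = vsum p n c) \<and>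
     (\<forall>c. (\<forall>i<n. c i \<in> Vs i) \<and> vsum p n c = vzero \<longrightarrow> (\<forall>i<n. c i = vzero))"

definition permutes_decomp :: "((nat \<Rightarrow> nat) \<Rightarrow> (nat \<Rightarrow> nat)) set \<Rightarrow> nat
     \<Rightarrow> (nat \<Rightarrow> (nat \<Rightarrow> nat) set) \<Rightarrow> bool" where
  "permutes_decomp G n Vs \<longleftrightarrow> (\<forall>g\<in>G. \<forall>i<n. \<exists>j<n. g ` Vs i = Vs j)"

definition imprimitive_lin :: "nat \<Rightarrow> nat \<Rightarrow> ((nat \<Rightarrow> nat) \<Rightarrow> (nat \<Rightarrow> nat)) set \<Rightarrow> bool" where
  "imprimitive_lin p d G \<longleftrightarrow>
     (\<exists>n Vs. n > 1 \<and> direct_decomp p d n Vs \<and> permutes_decomp G n Vs)"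

definition induced_perm :: "nat \<Rightarrow> (nat \<Rightarrow> (nat \<Rightarrow> nat) set) \<Rightarrow> ((nat \<Rightarrow> nat) \<Rightarrow> (nat \<Rightarrow> nat))
     \<Rightarrow> nat \<Rightarrow> nat" where
  "induced_perm n Vs g = (\<lambda>i. if i < n then (THE j. j < n \<and> g ` Vs i = Vs j) else i)"

definition induced_group :: "nat \<Rightarrow> (nat \<Rightarrow> (nat \<Rightarrow> nat) set)
     \<Rightarrow> ((nat \<Rightarrow> nat) \<Rightarrow> (nat \<Rightarrow> nat)) set \<Rightarrow> (nat \<Rightarrow> nat) set" where
  "induced_group n Vs G = induced_perm n Vs ` G"

definition is_perm_group :: "nat \<Rightarrow> (nat \<Rightarrow> nat) set \<Rightarrow> bool" where
  "is_perm_group n K \<longleftrightarrow> K \<noteq> {} \<and> (\<forall>\<sigma>\<in>K. \<sigma> permutes {..<n}) \<and>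
     (\<forall>\<sigma>\<in>K. \<forall>\<tau>\<in>K. \<sigma> \<circ> \<tau> \<in> K) \<and> (\<forall>\<sigma>\<in>K. Hilbert_Choice.inv \<sigma> \<in> K)"

definition primitive_perm :: "nat \<Rightarrow> (nat \<Rightarrow> nat) set \<Rightarrow> bool" where
  "primitive_perm n K \<longleftrightarrow>
     (\<forall>i<n. \<forall>j<n. \<exists>\<sigma>\<in>K. \<sigma> i = j) \<and>
     (\<forall>B. B \<subseteq> {..<n} \<and> B \<noteq> {} \<and> (\<forall>\<sigma>\<in>K. \<sigma> ` B = B \<or> \<sigma> ` B \<inter> B = {})
          \<longrightarrow> card B = 1 \<or> B = {..<n})"

definition p_concealed :: "nat \<Rightarrow> nat \<Rightarrow> (nat \<Rightarrow> nat) set \<Rightarrow> bool" where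
  "p_concealed p n K \<longleftrightarrow> p dvd card K \<and>
     (\<forall>A. A \<subseteq> {..<n} \<longrightarrow> coprime p (card ((\<lambda>\<sigma>. \<sigma> ` A) ` K)))"

end

theory Submission
  imports Defs
begin

text \<open>
  Let \<open>G\<close> act on a set, not trivially. As \<open>O_p' p d G = G\<close>, a Sylow \<open>p\<close>-subgroup \<open>P\<close> moves some point \<open>s\<close>,
  and the setwise stabiliser of the orbit \<open>Q = P s\<close> is transitive on \<open>Q\<close>, whose size is divisible
  by \<open>p\<close>. So a subgroup fixing both \<open>Q\<close> and \<open>s\<close> has index divisible by \<open>p\<close>, and by exceptionality it
  cannot contain the stabiliser of a vector. Both main claims follow by writing down a vector that
  determines such a pair \<open>(Q, s)\<close>.

  If \<open>u\<close> and \<open>w\<close> in \<open>V\<^sub>1\<close> were nonzero and not conjugate, let \<open>G\<close> act on the summands and take the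
  vector supported on \<open>Q\<close> with a conjugate of \<open>u\<close> at \<open>s\<close> and conjugates of \<open>w\<close> elsewhere. If there
  were a nontrivial block, let \<open>G\<close> act on its translates and take a vector supported on all of the
  block \<open>s\<close> and on one point of each other block in \<open>Q\<close>. The action is concealed because the
  stabiliser of a vector fixes its support.
\<close>

section \<open>Orbits and Sylow subgroups\<close>

text \<open>The fibres of the map sending \<open>g\<close> to \<open>act g x\<close> are left cosets
  of the stabiliser of \<open>x\<close>. The action laws are required only at the base point
  \<open>x\<close>, so no set acted on has to be named and the lemma also serves subgroups.\<close>

lemma (in group) card_orbit_times_stabilizer:
  assumes fin: "finite (carrier G)"
    and act_mult: "\<And>g h. g \<in> carrier G \<Longrightarrow> h \<in> carrier G \<Longrightarrow> act (g \<otimes> h) x = act g (act h x)"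
    and act_one: "act \<one> x = x"
  shows "card ((\<lambda>g. act g x) ` carrier G) * card {g \<in> carrier G. act g x = x} = card (carrier G)"
proof -
  let ?O = "(\<lambda>g. act g x) ` carrier G"
  let ?S = "{g \<in> carrier G. act g x = x}"
  have fibre: "card {g \<in> carrier G. act g x = y} = card ?S" if y: "y \<in> ?O" for y
  proof -
    obtain g where g: "g \<in> carrier G" "y = act g x" using y by blast
    have "{h \<in> carrier G. act h x = y} = (\<lambda>h. g \<otimes> h) ` ?S"
    proof
      show "{h \<in> carrier G. act h x = y} \<subseteq> (\<lambda>h. g \<otimes> h) ` ?S"
      proof
        fix h assume "h \<in> {h \<in> carrier G. act h x = y}"
        then have h: "h \<in> carrier G" "act h x = act g x" using g by auto
        have "act (inv g \<otimes> h) x = act (inv g) (act g x)"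
          unfolding h(2)[symmetric] using g(1) h(1) by (intro act_mult) auto
        also have "\<dots> = act (inv g \<otimes> g) x"
          using g(1) by (intro act_mult[symmetric]) auto
        also have "\<dots> = x" using g(1) by (simp only: l_inv act_one)
        finally have "inv g \<otimes> h \<in> ?S" using g(1) h(1) by simp
        moreover have "h = g \<otimes> (inv g \<otimes> h)" using g(1) h(1) by (simp only: m_assoc[symmetric] r_inv l_one inv_closed)
        ultimately show "h \<in> (\<lambda>h. g \<otimes> h) ` ?S" by blast
      qed
      show "(\<lambda>h. g \<otimes> h) ` ?S \<subseteq> {h \<in> carrier G. act h x = y}"
        using g act_mult by (smt (verit) image_subsetI m_closed mem_Collect_eq)
    qed
    moreover have "inj_on (\<lambda>h. g \<otimes> h) ?S"
      using g by (auto simp: inj_on_def)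
    ultimately show ?thesis by (simp add: card_image)
  qed
  have "card (carrier G) = card (\<Union>y\<in>?O. {g \<in> carrier G. act g x = y})"
    by (rule arg_cong[where f = card]) auto
  also have "\<dots> = (\<Sum>y\<in>?O. card {g \<in> carrier G. act g x = y})"
    using fin by (intro card_UN_disjoint) auto
  also have "\<dots> = card ?O * card ?S" by (simp add: fibre)
  finally show ?thesis by simp
qed

lemma (in group) card_subgroup_dvd:
  assumes "finite (carrier G)" "subgroup H G" "subgroup K G" "H \<subseteq> K"
  shows "card H dvd card K"
proof -
  interpret K: group "G\<lparr>carrier := K\<rparr>" using assms subgroup_imp_group by blast
  have "card H dvd order (G\<lparr>carrier := K\<rparr>)"
    unfolding K.lagrange[OF subgroup_incl[OF assms(2-4)], symmetric] by (rule dvd_triv_right)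
  then show ?thesis by (simp add: order_def)
qed

section \<open>Actions on a set and subgroups of index divisible by \<open>p\<close>\<close>

locale set_action = group G for G (structure) +
  fixes S :: "'s set" and act :: "'a \<Rightarrow> 's \<Rightarrow> 's"
  assumes act_closed: "g \<in> carrier G \<Longrightarrow> s \<in> S \<Longrightarrow> act g s \<in> S"
    and act_mult: "g \<in> carrier G \<Longrightarrow> h \<in> carrier G \<Longrightarrow> s \<in> S \<Longrightarrow> act (g \<otimes> h) s = act g (act h s)"
    and act_one: "s \<in> S \<Longrightarrow> act \<one> s = s"
begin

lemma act_inv_cancel: "g \<in> carrier G \<Longrightarrow> s \<in> S \<Longrightarrow> act (inv g) (act g s) = s"
  by (metis act_mult act_one inv_closed l_inv)

lemma act_inv_fixed: "g \<in> carrier G \<Longrightarrow> s \<in> S \<Longrightarrow> act g s = s \<Longrightarrow> act (inv g) s = s"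
  by (metis act_inv_cancel)

lemma subgroup_stabilizer:
  assumes "s \<in> S"
  shows "subgroup {g \<in> carrier G. act g s = s} G"
  using assms by (intro subgroupI) (auto simp: act_mult act_one act_inv_fixed)

lemma subgroup_setwise_stabilizer:
  assumes "Q \<subseteq> S"
  shows "subgroup {g \<in> carrier G. act g ` Q = Q} G"
proof (intro subgroupI)
  have *: "act (g \<otimes> h) ` Q = act g ` act h ` Q" if "g \<in> carrier G" "h \<in> carrier G" for g h
    using assms that by (auto simp: act_mult subset_eq image_iff)
  have one: "act \<one> ` Q = Q" using assms by (force simp: act_one)
  show "{g \<in> carrier G. act g ` Q = Q} \<noteq> {}" using one by auto
  show "g \<otimes> h \<in> {g \<in> carrier G. act g ` Q = Q}"
    if "g \<in> {g \<in> carrier G. act g ` Q = Q}" "h \<in> {g \<in> carrier G. act g ` Q = Q}" for g h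
    using that by (simp add: *)
  show "inv g \<in> {g \<in> carrier G. act g ` Q = Q}" if "g \<in> {g \<in> carrier G. act g ` Q = Q}" for g
    using that *[of "inv g" g] one by simp
qed auto

text \<open>The kernel of an action is the normal subgroup to which the lack of proper normal
  subgroups of index coprime to \<open>p\<close> gets applied.\<close>

lemma normal_kernel: "normal {g \<in> carrier G. \<forall>s\<in>S. act g s = s} G"
proof -
  let ?N = "{g \<in> carrier G. \<forall>s\<in>S. act g s = s}"
  have "subgroup ?N G"
    by (intro subgroupI) (auto simp: act_mult act_one act_inv_fixed intro: exI[of _ \<one>])
  moreover have "x \<otimes> h \<otimes> inv x \<in> ?N" if x: "x \<in> carrier G" and h: "h \<in> ?N" for x h
  proof -
    have "act (x \<otimes> h \<otimes> inv x) s = s" if s: "s \<in> S" for s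
    proof -
      have "act (x \<otimes> h \<otimes> inv x) s = act x (act h (act (inv x) s))"
        using x h s by (simp add: act_mult act_closed)
      also have "\<dots> = act x (act (inv x) s)" using x h s by (simp add: act_closed)
      also have "\<dots> = s" using act_inv_cancel[of "inv x" s] x s by simp
      finally show ?thesis .
    qed
    then show ?thesis using x h by simp
  qed
  ultimately show ?thesis by (simp add: normal_inv_iff)
qed

text \<open>\<open>Q\<close> is the orbit of a point \<open>s\<close> moved by a Sylow subgroup. The
  divisibility says, without forming a quotient, that the index of \<open>K\<close> is a multiple of
  \<open>p\<close>.\<close>

lemma ex_p_divisible_flag:
  assumes fin: "finite (carrier G)"
    and p: "Factorial_Ring.prime (p::nat)"
    and no_p'_quotient: "\<And>N. normal N G \<Longrightarrow> coprime p (order G div card N) \<Longrightarrow> N = carrier G"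
    and moved: "g \<in> carrier G" "s0 \<in> S" "act g s0 \<noteq> s0"
  shows "\<exists>s Q. Q \<subseteq> S \<and> s \<in> Q \<and>
    (\<forall>K. subgroup K G \<longrightarrow> (\<forall>k\<in>K. act k ` Q = Q \<and> act k s = s) \<longrightarrow> p * card K dvd order G)"
proof -
  have "order G \<noteq> 0" using fin order_gt_0_iff_finite by simp
  then obtain m where m: "order G = p ^ multiplicity p (order G) * m" "\<not> p dvd m"
    using multiplicity_decompose'[of "order G" p] not_prime_unit p by blast
  define a where "a = multiplicity p (order G)"
  obtain P where P: "subgroup P G" "card P = p ^ a"
    using sylow_thm[OF p is_group _ fin, of a m] m(1) a_def by blast
  define N where "N = {g \<in> carrier G. \<forall>s\<in>S. act g s = s}"
  have N: "normal N G" unfolding N_def by (rule normal_kernel)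
  then have sN: "subgroup N G" by (simp add: normal_imp_subgroup)
  \<comment> \<open>If the Sylow subgroup \<open>P\<close> acted trivially, the index of the kernel
    \<open>N\<close> would divide the part \<open>m\<close> of the order that is prime to
    \<open>p\<close>; then \<open>N\<close> would be the whole group and nothing would move.\<close>
  have "\<not> P \<subseteq> N"
  proof
    assume "P \<subseteq> N"
    then have "p ^ a dvd card N" using card_subgroup_dvd[OF fin P(1) sN] P by simp
    moreover have "card N dvd order G" 
      using card_subgroup_dvd[OF fin sN subgroup_self subgroup.subset[OF sN]] by (simp add: order_def)
    ultimately obtain q r where qr: "card N = p ^ a * r" "order G = card N * q"
      by (elim dvdE) blast
    then have "r * q = m"
      using m(1) prime_gt_0_nat[OF p] unfolding a_def[symmetric] by simp
    moreover have "order G div card N = q" using qr \<open>order G \<noteq> 0\<close> by auto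
    ultimately have "order G div card N dvd m" by auto
    then have "coprime p (order G div card N)"
      using m(2) p by (metis dvd_trans prime_imp_coprime)
    then have "N = carrier G" using no_p'_quotient N by blast
    then show False using moved N_def by blast
  qed
  then obtain h s where hs: "h \<in> P" "s \<in> S" "act h s \<noteq> s"
    using P(1) subgroup.subset unfolding N_def by blast
  define Q where "Q = (\<lambda>g. act g s) ` P"
  interpret P: group "G\<lparr>carrier := P\<rparr>" using P subgroup_imp_group by blast
  have Pc: "P \<subseteq> carrier G" and oneP: "\<one> \<in> P"
    using P subgroup.subset subgroup.one_closed by auto
  have finP: "finite P" using fin Pc finite_subset by blast
  have "card Q * card {g \<in> P. act g s = s} = p ^ a"
    using P.card_orbit_times_stabilizer[of act s] finP hs Pc P(2) unfolding Q_def
    by (simp add: act_mult act_one subset_eq)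
  then have "card Q dvd p ^ a" by (metis dvd_triv_left)
  then obtain i where i: "card Q = p ^ i" using divides_primepow_nat[OF p] by blast
  have sQ: "s \<in> Q" unfolding Q_def using oneP hs act_one by force
  have QS: "Q \<subseteq> S" unfolding Q_def using act_closed hs Pc by blast
  \<comment> \<open>The orbit contains both \<open>s\<close> and \<open>act h s\<close>, so its size
    is a nontrivial power of \<open>p\<close>.\<close>
  have "i \<noteq> 0"
  proof
    assume "i = 0"
    then have "card Q = 1" using i by simp
    then obtain z where "Q = {z}" by (metis card_1_singletonE)
    then show False using hs sQ unfolding Q_def by (metis image_eqI singletonD)
  qed
  then have pQ: "p dvd card Q" using i by simp
  define T where "T = {g \<in> carrier G. act g ` Q = Q}"
  have T: "subgroup T G" unfolding T_def by (rule subgroup_setwise_stabilizer[OF QS])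
  interpret T: group "G\<lparr>carrier := T\<rparr>" using T subgroup_imp_group by blast
  have Tc: "T \<subseteq> carrier G" unfolding T_def by blast
  have finT: "finite T" using Tc fin finite_subset by blast
  have PT: "P \<subseteq> T"
  proof
    fix x assume x: "x \<in> P"
    have sub: "act y ` Q \<subseteq> Q" if "y \<in> P" for y
      using that P Pc hs by (auto simp: Q_def act_mult[symmetric] subset_eq subgroup.m_closed)
    have "Q \<subseteq> act x ` Q"
    proof
      fix q assume q: "q \<in> Q"
      then have "act (inv x) q \<in> Q"
        using sub[OF subgroup.m_inv_closed[OF P(1) x]] by (simp add: image_subset_iff)
      moreover have "act x (act (inv x) q) = q"
        using act_inv_cancel[of "inv x" q] subsetD[OF Pc x] subsetD[OF QS q] by simp
      ultimately show "q \<in> act x ` Q" by (metis imageI)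
    qed
    then show "x \<in> T" using sub[OF x] x Pc unfolding T_def by blast
  qed
  \<comment> \<open>\<open>P\<close> already carries \<open>s\<close> to every point of
    \<open>Q\<close>, and \<open>T\<close> preserves \<open>Q\<close>; hence \<open>T\<close> is
    transitive on \<open>Q\<close>.\<close>
  have orbT: "(\<lambda>g. act g s) ` T = Q"
    using PT sQ unfolding T_def Q_def by blast
  have cT: "card Q * card {g \<in> T. act g s = s} = card T"
    using T.card_orbit_times_stabilizer[of act s] finT hs Tc orbT
    by (simp add: act_mult act_one subset_eq)
  \<comment> \<open>\<open>K\<close> lies in the stabiliser of \<open>s\<close> in \<open>T\<close>,
    whose index in \<open>T\<close> is \<open>card Q\<close>, a multiple of
    \<open>p\<close>.\<close>
  have "p * card K dvd order G"
    if K: "subgroup K G" "\<forall>k\<in>K. act k ` Q = Q \<and> act k s = s" for K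
  proof -
    have "K \<subseteq> {g \<in> T. act g s = s}" using K subgroup.subset[OF K(1)] unfolding T_def by blast
    moreover have "subgroup {g \<in> T. act g s = s} G"
    proof -
      have "{g \<in> T. act g s = s} = T \<inter> {g \<in> carrier G. act g s = s}" using Tc by blast
      then show ?thesis using subgroups_Inter_pair[OF T subgroup_stabilizer[OF hs(2)]] by simp
    qed
    ultimately have "card K dvd card {g \<in> T. act g s = s}"
      using card_subgroup_dvd[OF fin K(1)] by blast
    then have "p * card K dvd card T" using cT pQ by (metis mult_dvd_mono)
    moreover have "card T dvd order G"
      using card_subgroup_dvd[OF fin T subgroup_self Tc] by (simp add: order_def)
    ultimately show ?thesis by (rule dvd_trans)
  qed
  then show ?thesis using QS sQ by (intro exI[of _ s] exI[of _ Q]) simp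
qed

end

section \<open>Components and supports in a direct sum\<close>

lemma finite_vecs: "finite (vecs p d)"
proof -
  have "vecs p d \<subseteq> {v. \<forall>k. (k \<in> {..<d} \<longrightarrow> v k \<in> {..<p}) \<and> (k \<notin> {..<d} \<longrightarrow> v k = 0)}"
    by (auto simp: vecs_def)
  then show ?thesis
    using finite_set_of_finite_funs[of "{..<d}" "{..<p}" 0] finite_subset by blast
qed

lemma vecs_less: "v \<in> vecs p d \<Longrightarrow> p > 0 \<Longrightarrow> v k < p"
  by (cases "k < d") (auto simp: vecs_def)

lemma vzero_in_vecs: "p > 0 \<Longrightarrow> vzero \<in> vecs p d"
  by (simp add: vecs_def vzero_def)

lemma vadd_in_vecs: "p > 0 \<Longrightarrow> v \<in> vecs p d \<Longrightarrow> w \<in> vecs p d \<Longrightarrow> vadd p v w \<in> vecs p d"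
  by (simp add: vecs_def vadd_def)

lemma vsmul_in_vecs: "p > 0 \<Longrightarrow> v \<in> vecs p d \<Longrightarrow> vsmul p c v \<in> vecs p d"
  by (simp add: vecs_def vsmul_def)

lemma vsum_in_vecs: "p > 0 \<Longrightarrow> (\<And>i. i < n \<Longrightarrow> c i \<in> vecs p d) \<Longrightarrow> vsum p n c \<in> vecs p d"
  by (simp add: vecs_def vsum_def)

lemma vadd_vzero: "p > 0 \<Longrightarrow> vadd p vzero vzero = vzero"
  by (simp add: vadd_def vzero_def)

lemma vsmul_vzero: "vsmul p c vzero = vzero"
  by (simp add: vsmul_def vzero_def)

lemma vsum_0: "vsum p 0 c = vzero"
  by (simp add: vsum_def vzero_def)

lemma vsum_Suc: "vsum p (Suc m) c = vadd p (vsum p m c) (c m)"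
  by (simp add: vsum_def vadd_def mod_simps)

lemma vsum_vadd: "vsum p n (\<lambda>i. vadd p (c i) (e i)) = vadd p (vsum p n c) (vsum p n e)"
  by (simp add: vsum_def vadd_def mod_sum_eq mod_simps sum.distrib)

lemma vsum_vsmul: "vsum p n (\<lambda>i. vsmul p a (c i)) = vsmul p a (vsum p n c)"
  by (simp add: vsum_def vsmul_def mod_sum_eq mod_simps sum_distrib_left)

lemma vsum_permute:
  assumes "\<sigma> permutes {..<n}"
  shows "vsum p n (\<lambda>i. c (\<sigma> i)) = vsum p n c"
proof
  fix k
  have "(\<Sum>i<n. c (\<sigma> i) k) = (\<Sum>i<n. c i k)"
    using sum.permute[OF assms, of "\<lambda>i. c i k"] by (simp add: comp_def)
  then show "vsum p n (\<lambda>i. c (\<sigma> i)) k = vsum p n c k" by (simp add: vsum_def)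
qed

lemma vsum_single:
  assumes "i < n" "x \<in> vecs p d" "p > 0"
  shows "vsum p n (\<lambda>j. if j = i then x else vzero) = x"
proof
  fix k
  have "(\<Sum>j<n. (if j = i then x else vzero) k) = (\<Sum>j<n. if j = i then x k else 0)"
    by (rule sum.cong) (auto simp: vzero_def)
  then show "vsum p n (\<lambda>j. if j = i then x else vzero) k = x k"
    using assms vecs_less by (simp add: vsum_def)
qed

text \<open>The scalar \<open>p - 1\<close> stands for -1, so the last hypothesis says that a
  difference vanishes modulo \<open>p\<close>. Entries below \<open>p\<close> turn the congruence
  into equality.\<close>

lemma eq_if_vadd_vsmul_eq_vzero:
  assumes "v \<in> vecs p d" "w \<in> vecs p d" "p > 0" "vadd p v (vsmul p (p - 1) w) = vzero"
  shows "v = w"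
proof
  fix k
  have *: "(p - 1) * w k + w k = p * w k"
    using \<open>p > 0\<close> by (metis add.commute Suc_diff_1 mult_Suc)
  have "(v k + (p - 1) * w k) mod p = 0"
    using fun_cong[OF assms(4), of k] by (simp add: vadd_def vsmul_def vzero_def mod_simps)
  then have "w k mod p = (v k + (p - 1) * w k + w k) mod p"
    by (metis add_0 mod_add_left_eq)
  also have "\<dots> = v k mod p" by (simp only: add.assoc *) simp
  finally show "v k = w k" using assms vecs_less by (metis mod_less)
qed

lemma vadd_vsmul_cancel:
  assumes "p > 0"
  shows "vadd p v (vsmul p (p - 1) v) = vzero"
proof
  fix k
  have "(v k + (p - 1) * v k) = p * v k"
    using \<open>p > 0\<close> by (metis Suc_diff_1 mult_Suc)
  then show "vadd p v (vsmul p (p - 1) v) k = vzero k"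
    by (simp add: vadd_def vsmul_def vzero_def mod_simps)
qed

section \<open>Unique components of a vector\<close>

locale direct_sum =
  fixes p d n :: nat and Vs :: "nat \<Rightarrow> (nat \<Rightarrow> nat) set"
  assumes prime_p: "Factorial_Ring.prime p"
    and decomp: "direct_decomp p d n Vs"
begin

lemma p_gt_1: "p > 1" using prime_p prime_gt_1_nat by blast

lemma p_pos: "p > 0" using p_gt_1 by simp

lemma summand: "i < n \<Longrightarrow> subspace_of p d (Vs i)"
  using decomp by (simp add: direct_decomp_def)

lemma summand_subset: "i < n \<Longrightarrow> x \<in> Vs i \<Longrightarrow> x \<in> vecs p d"
  using summand[of i] by (auto simp: subspace_of_def)

lemma vzero_in_summand: "i < n \<Longrightarrow> vzero \<in> Vs i"
  using summand by (simp add: subspace_of_def)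

lemma vadd_in_summand: "i < n \<Longrightarrow> x \<in> Vs i \<Longrightarrow> y \<in> Vs i \<Longrightarrow> vadd p x y \<in> Vs i"
  using summand by (simp add: subspace_of_def)

lemma vsmul_in_summand: "i < n \<Longrightarrow> x \<in> Vs i \<Longrightarrow> a < p \<Longrightarrow> vsmul p a x \<in> Vs i"
  using summand by (simp add: subspace_of_def)

lemma ex_nonzero: "i < n \<Longrightarrow> \<exists>x\<in>Vs i. x \<noteq> vzero"
proof -
  assume i: "i < n"
  then have "Vs i \<noteq> {vzero}" using decomp by (simp add: direct_decomp_def)
  then show ?thesis using vzero_in_summand[OF i] by auto
qed

definition pick :: "nat \<Rightarrow> nat \<Rightarrow> nat" where
  "pick i = (SOME x. x \<in> Vs i \<and> x \<noteq> vzero)"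

lemma pick: "i < n \<Longrightarrow> pick i \<in> Vs i \<and> pick i \<noteq> vzero"
  unfolding pick_def by (rule someI_ex[of "\<lambda>x. x \<in> Vs i \<and> x \<noteq> vzero"]) (use ex_nonzero[of i] in blast)

text \<open>Directness is given only for sums equal to zero, so it is applied to the differences of
  \<open>c\<close> and \<open>e\<close>.\<close>

lemma vsum_inject:
  assumes "\<And>i. i < n \<Longrightarrow> c i \<in> Vs i" "\<And>i. i < n \<Longrightarrow> e i \<in> Vs i" "vsum p n c = vsum p n e" "i < n"
  shows "c i = e i"
proof -
  let ?f = "\<lambda>i. vadd p (c i) (vsmul p (p - 1) (e i))"
  have "vsum p n ?f = vadd p (vsum p n c) (vsmul p (p - 1) (vsum p n c))"
    by (simp add: vsum_vadd vsum_vsmul assms(3))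
  then have sum0: "vsum p n ?f = vzero" using vadd_vsmul_cancel p_pos by simp
  have mem: "\<forall>i<n. ?f i \<in> Vs i"
    using assms p_pos by (simp add: vadd_in_summand vsmul_in_summand)
  have "(\<forall>i<n. f i \<in> Vs i) \<and> vsum p n f = vzero \<longrightarrow> (\<forall>i<n. f i = vzero)" for f
    using conjunct2[OF conjunct2[OF decomp[unfolded direct_decomp_def]]] by (rule spec)
  from spec[OF mp[OF this conjI[OF mem sum0]], of i] \<open>i < n\<close> have "?f i = vzero" by (rule mp)
  then show ?thesis
    by (rule eq_if_vadd_vsmul_eq_vzero[OF summand_subset summand_subset p_pos, OF assms(4) assms(1) assms(4) assms(2), OF assms(4) assms(4)])
qed

text \<open>For \<open>v\<close> in the space the choice is forced at indices below
  \<open>n\<close>, by \<open>vsum_inject\<close>; at other indices the value is arbitrary.\<close>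

definition component :: "(nat \<Rightarrow> nat) \<Rightarrow> nat \<Rightarrow> nat \<Rightarrow> nat" where
  "component v = (SOME c. (\<forall>i<n. c i \<in> Vs i) \<and> v = vsum p n c)"

lemma component:
  assumes "v \<in> vecs p d"
  shows "(\<forall>i<n. component v i \<in> Vs i) \<and> v = vsum p n (component v)"
  unfolding component_def
  by (rule someI_ex[of "\<lambda>c. (\<forall>i<n. c i \<in> Vs i) \<and> v = vsum p n c"])
    (use assms decomp in \<open>simp add: direct_decomp_def\<close>)

lemma component_in: "v \<in> vecs p d \<Longrightarrow> i < n \<Longrightarrow> component v i \<in> Vs i"
  and vsum_component: "v \<in> vecs p d \<Longrightarrow> vsum p n (component v) = v"
  using component by auto

lemma vsum_summands_in_vecs: "(\<And>i. i < n \<Longrightarrow> c i \<in> Vs i) \<Longrightarrow> vsum p n c \<in> vecs p d"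
  by (rule vsum_in_vecs[OF p_pos summand_subset])

lemma component_vsum:
  assumes "\<And>i. i < n \<Longrightarrow> c i \<in> Vs i" "i < n"
  shows "component (vsum p n c) i = c i"
proof -
  have v: "vsum p n c \<in> vecs p d" using assms(1) by (rule vsum_summands_in_vecs)
  show ?thesis
    using component_in[OF v] assms(1) vsum_component[OF v] assms(2) by (rule vsum_inject)
qed

lemma component_vadd:
  assumes "v \<in> vecs p d" "w \<in> vecs p d" "i < n"
  shows "component (vadd p v w) i = vadd p (component v i) (component w i)"
proof -
  have "vadd p v w = vsum p n (\<lambda>i. vadd p (component v i) (component w i))"
    using assms by (simp add: vsum_vadd vsum_component)
  then show ?thesis
    using component_vsum[of "\<lambda>i. vadd p (component v i) (component w i)"] assms
    by (simp add: vadd_in_summand component_in)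
qed

lemma component_vsmul:
  assumes "v \<in> vecs p d" "a < p" "i < n"
  shows "component (vsmul p a v) i = vsmul p a (component v i)"
proof -
  have "vsmul p a v = vsum p n (\<lambda>i. vsmul p a (component v i))"
    using assms by (simp add: vsum_vsmul vsum_component)
  then show ?thesis
    using component_vsum[of "\<lambda>i. vsmul p a (component v i)"] assms
    by (simp add: vsmul_in_summand component_in)
qed

lemma component_summand:
  assumes "i < n" "x \<in> Vs i" "j < n"
  shows "component x j = (if j = i then x else vzero)"
  using component_vsum[of "\<lambda>j. if j = i then x else vzero" j] assms
    vsum_single[OF assms(1) summand_subset[OF assms(1,2)] p_pos]
  by (auto simp: vzero_in_summand)

lemma summand_unique:
  assumes "i < n" "j < n" "x \<in> Vs i" "x \<in> Vs j" "x \<noteq> vzero"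
  shows "i = j"
  using component_summand[of i x i] component_summand[of j x i] assms by (auto split: if_splits)

lemma inj_on_summands: "inj_on Vs {..<n}"
proof (rule inj_onI)
  fix i j assume "i \<in> {..<n}" "j \<in> {..<n}" "Vs i = Vs j"
  then show "i = j" using summand_unique[of i j "pick i"] pick[of i] by simp
qed

section \<open>Supports of vectors\<close>

definition supp :: "(nat \<Rightarrow> nat) \<Rightarrow> nat set" where
  "supp v = {i. i < n \<and> component v i \<noteq> vzero}"

lemma supp_vsum:
  assumes "\<And>i. i < n \<Longrightarrow> c i \<in> Vs i"
  shows "supp (vsum p n c) = {i. i < n \<and> c i \<noteq> vzero}"
  unfolding supp_def by (auto simp: component_vsum[OF assms])

lemma supp_summand:
  assumes "i < n" "x \<in> Vs i" "x \<noteq> vzero"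
  shows "supp x = {i}"
  using assms component_summand unfolding supp_def by auto

text \<open>This is the sum of the summands indexed by \<open>I\<close>; irreducibility is tested on
  it to obtain transitivity on the summands.\<close>

lemma subspace_supp:
  "subspace_of p d {v \<in> vecs p d. supp v \<subseteq> I}"
proof -
  have "supp vzero = {}"
    using component_summand[OF _ vzero_in_summand] by (auto simp: supp_def)
  moreover have "supp (vadd p v w) \<subseteq> I"
    if "v \<in> vecs p d" "w \<in> vecs p d" "supp v \<subseteq> I" "supp w \<subseteq> I" for v w
  proof
    fix i assume i: "i \<in> supp (vadd p v w)"
    show "i \<in> I"
    proof (rule ccontr)
      assume "i \<notin> I"
      then have "i \<notin> supp v" "i \<notin> supp w" using that by auto
      then show False 
        using i component_vadd[OF that(1,2), of i] vadd_vzero[OF p_pos] by (simp add: supp_def)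
    qed
  qed
  moreover have "supp (vsmul p a v) \<subseteq> I"
    if "v \<in> vecs p d" "a < p" "supp v \<subseteq> I" for v a
    using that by (auto simp: supp_def component_vsmul vsmul_vzero)
  ultimately show ?thesis
    using p_pos by (auto simp: subspace_of_def vzero_in_vecs vadd_in_vecs vsmul_in_vecs)
qed

text \<open>A vector with prescribed support, by which questions about sets of indices become
  questions about vectors.\<close>

definition support_vec :: "nat set \<Rightarrow> nat \<Rightarrow> nat" where
  "support_vec I = vsum p n (\<lambda>i. if i \<in> I then pick i else vzero)"

lemma support_vec:
  assumes "I \<subseteq> {..<n}"
  shows "support_vec I \<in> vecs p d" "supp (support_vec I) = I"
proof -
  have *: "(if i \<in> I then pick i else vzero) \<in> Vs i" if "i < n" for i
    using that pick vzero_in_summand by simp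
  show "support_vec I \<in> vecs p d"
    unfolding support_vec_def using * by (rule vsum_summands_in_vecs)
  show "supp (support_vec I) = I"
    unfolding support_vec_def using assms pick by (subst supp_vsum[OF *]) auto
qed

end

section \<open>Linear groups permuting the summands\<close>

locale permuted_sum = direct_sum +
  fixes G :: "((nat \<Rightarrow> nat) \<Rightarrow> (nat \<Rightarrow> nat)) set"
  assumes subgroup_G: "subgroup G (BijGroup (vecs p d))"
    and linear_G: "G \<subseteq> GL p d"
    and permutes_G: "permutes_decomp G n Vs"
begin

abbreviation perm where "perm \<equiv> induced_perm n Vs"

sublocale group "grp p d G"
  using subgroup.subgroup_is_group[OF subgroup_G group_BijGroup] .

lemma Bij_G: "g \<in> G \<Longrightarrow> g \<in> Bij (vecs p d)"
  using linear_G by (auto simp: GL_def)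

lemma maps_vecs: "g \<in> G \<Longrightarrow> v \<in> vecs p d \<Longrightarrow> g v \<in> vecs p d"
  using Bij_imp_funcset[OF Bij_G] by blast

lemma inj_on_vecs: "g \<in> G \<Longrightarrow> inj_on g (vecs p d)"
  using Bij_G by (simp add: Bij_def bij_betw_def)

lemma mult_apply:
  "g \<in> G \<Longrightarrow> h \<in> G \<Longrightarrow> v \<in> vecs p d \<Longrightarrow> (g \<otimes>\<^bsub>BijGroup (vecs p d)\<^esub> h) v = g (h v)"
  using Bij_G by (simp add: BijGroup_def compose_def)

lemma one_apply: "v \<in> vecs p d \<Longrightarrow> \<one>\<^bsub>BijGroup (vecs p d)\<^esub> v = v"
  by (simp add: BijGroup_def)

sublocale vecs: set_action "grp p d G" "vecs p d" "\<lambda>g v. g v"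
  by unfold_locales (simp_all add: maps_vecs mult_apply one_apply)

lemma finite_G: "finite G"
proof (rule finite_subset)
  show "G \<subseteq> vecs p d \<rightarrow>\<^sub>E vecs p d"
    using Bij_G by (auto simp: Bij_def PiE_def bij_betw_def)
  show "finite (vecs p d \<rightarrow>\<^sub>E vecs p d)" using finite_vecs by (intro finite_PiE) auto
qed

lemma apply_vzero: "g \<in> G \<Longrightarrow> g vzero = vzero"
proof -
  assume "g \<in> G"
  then have "g (vsmul p 0 vzero) = vsmul p 0 (g vzero)"
    using linear_G p_pos vzero_in_vecs by (auto simp: GL_def)
  then show ?thesis by (simp add: vsmul_def vzero_def)
qed

lemma apply_eq_vzero_iff:
  assumes "g \<in> G" "v \<in> vecs p d"
  shows "g v = vzero \<longleftrightarrow> v = vzero"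
  using inj_onD[OF inj_on_vecs[OF assms(1)], of v vzero] apply_vzero assms vzero_in_vecs[OF p_pos]
  by auto

lemma apply_vsum:
  assumes "g \<in> G"
  shows "(\<And>i. i < m \<Longrightarrow> c i \<in> vecs p d) \<Longrightarrow> g (vsum p m c) = vsum p m (\<lambda>i. g (c i))"
proof (induction m)
  case 0
  then show ?case using assms by (simp add: vsum_0 apply_vzero)
next
  case (Suc m)
  have "vsum p m c \<in> vecs p d" "c m \<in> vecs p d"
    using Suc.prems vsum_in_vecs[OF p_pos, of m c] by auto
  then have "g (vadd p (vsum p m c) (c m)) = vadd p (g (vsum p m c)) (g (c m))"
    using assms linear_G by (auto simp: GL_def)
  then show ?case using Suc by (simp add: vsum_Suc)
qed

text \<open>Distinct indices have distinct summands, so only one index meets the definite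
  description in \<open>induced_perm\<close>.\<close>

lemma perm_eqI:
  assumes "i < n" "j < n" "g ` Vs i = Vs j"
  shows "perm g i = j"
  using assms inj_onD[OF inj_on_summands] by (auto simp: induced_perm_def intro!: the_equality)

lemma perm_less: "g \<in> G \<Longrightarrow> i < n \<Longrightarrow> perm g i < n"
  and image_summand: "g \<in> G \<Longrightarrow> i < n \<Longrightarrow> g ` Vs i = Vs (perm g i)"
proof -
  assume "g \<in> G" "i < n"
  then obtain j where "j < n" "g ` Vs i = Vs j"
    using permutes_G unfolding permutes_decomp_def by blast
  with perm_eqI[OF \<open>i < n\<close> this] show "perm g i < n" "g ` Vs i = Vs (perm g i)" by auto
qed

lemma perm_ge: "\<not> i < n \<Longrightarrow> perm g i = i"
  by (simp add: induced_perm_def)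

text \<open>Different summands share only the zero vector, so the image of a single nonzero vector
  shows where its whole summand goes.\<close>

lemma perm_eqI_vector:
  assumes "g \<in> G" "i < n" "j < n" "x \<in> Vs i" "g x \<in> Vs j" "x \<noteq> vzero"
  shows "perm g i = j"
proof -
  have "g x \<in> Vs (perm g i)" using assms image_summand by blast
  moreover have "g x \<noteq> vzero" using assms apply_eq_vzero_iff summand_subset by blast
  ultimately show ?thesis using summand_unique perm_less assms by blast
qed

lemma perm_mult:
  assumes "g \<in> G" "h \<in> G"
  shows "perm (g \<otimes>\<^bsub>BijGroup (vecs p d)\<^esub> h) = perm g \<circ> perm h"
proof
  fix i
  show "perm (g \<otimes>\<^bsub>BijGroup (vecs p d)\<^esub> h) i = (perm g \<circ> perm h) i"
  proof (cases "i < n")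
    case True
    have "(g \<otimes>\<^bsub>BijGroup (vecs p d)\<^esub> h) ` Vs i = (\<lambda>x. g (h x)) ` Vs i"
      by (rule image_cong) (use True assms summand_subset mult_apply in auto)
    also have "\<dots> = g ` h ` Vs i" by (simp add: image_image)
    also have "\<dots> = Vs (perm g (perm h i))" using True assms by (simp add: image_summand perm_less)
    finally show ?thesis using True assms by (simp add: perm_eqI perm_less)
  qed (simp add: perm_ge)
qed

lemma perm_one: "perm \<one>\<^bsub>BijGroup (vecs p d)\<^esub> = id"
proof
  fix i
  show "perm \<one>\<^bsub>BijGroup (vecs p d)\<^esub> i = id i"
  proof (cases "i < n")
    case True
    have "\<one>\<^bsub>BijGroup (vecs p d)\<^esub> ` Vs i = (\<lambda>x. x) ` Vs i"
      by (rule image_cong) (use True summand_subset one_apply in auto)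
    then show ?thesis using True perm_eqI by simp
  qed (simp add: perm_ge)
qed

lemma inv_closed_G: "g \<in> G \<Longrightarrow> inv\<^bsub>grp p d G\<^esub> g \<in> G"
  using inv_closed by simp

lemma perm_inv: "g \<in> G \<Longrightarrow> perm g \<circ> perm (inv\<^bsub>grp p d G\<^esub> g) = id"
  "g \<in> G \<Longrightarrow> perm (inv\<^bsub>grp p d G\<^esub> g) \<circ> perm g = id"
  using perm_mult[of g "inv\<^bsub>grp p d G\<^esub> g"] perm_mult[of "inv\<^bsub>grp p d G\<^esub> g" g]
    r_inv[of g] l_inv[of g] inv_closed_G[of g] perm_one by simp_all

lemma bij_perm: "g \<in> G \<Longrightarrow> bij (perm g)"
  using perm_inv o_bij by blast

lemma perm_permutes: "g \<in> G \<Longrightarrow> perm g permutes {..<n}"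
  using bij_perm perm_ge by (simp add: permutes_def bij_iff)

sublocale idx: set_action "grp p d G" "{..<n}" perm
  by unfold_locales (use perm_less perm_mult perm_one in auto)

sublocale subsets: set_action "grp p d G" "Pow {..<n}" "\<lambda>g. image (perm g)"
  by unfold_locales (use perm_less perm_mult perm_one in \<open>auto simp: image_comp\<close>)

text \<open>Applying \<open>g\<close> to the decomposition of \<open>v\<close> gives one vector in
  each summand again, and uniqueness of components identifies them.\<close>

lemma component_perm:
  assumes "g \<in> G" "v \<in> vecs p d" "i < n"
  shows "component (g v) (perm g i) = g (component v i)"
proof -
  \<comment> \<open>The images are listed by the summand in which they land, hence the inverse
    permutation.\<close>
  define c where "c j = g (component v (inv_into UNIV (perm g) j))" for j
  have c_perm: "c (perm g i) = g (component v i)" for i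
    using bij_perm[OF assms(1)] by (simp add: c_def bij_def)
  have mem: "c j \<in> Vs j" if "j < n" for j
  proof -
    obtain i where i: "i < n" "j = perm g i"
      using permutes_image[OF perm_permutes[OF assms(1)]] \<open>j < n\<close> by auto
    have "g (component v i) \<in> g ` Vs i" using component_in[OF assms(2) i(1)] by simp
    then show ?thesis using i image_summand[OF assms(1)] c_perm by simp
  qed
  have "g v = g (vsum p n (component v))" using vsum_component assms by simp
  also have "\<dots> = vsum p n (\<lambda>i. g (component v i))"
    by (rule apply_vsum[OF assms(1) summand_subset]) (auto simp: component_in[OF assms(2)])
  also have "\<dots> = vsum p n c"
    using vsum_permute[OF perm_permutes[OF assms(1)], of p c] c_perm by simp
  finally show ?thesis
    using component_vsum[OF mem, of "perm g i"] perm_less[OF assms(1,3)] c_perm by simp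
qed

text \<open>Equivariance of the support: an element fixing a vector must preserve its
  support.\<close>

lemma supp_apply:
  assumes "g \<in> G" "v \<in> vecs p d"
  shows "supp (g v) = perm g ` supp v"
proof -
  have iff: "perm g i \<in> supp (g v) \<longleftrightarrow> i \<in> supp v" if "i < n" for i
    using that assms component_perm perm_less apply_eq_vzero_iff summand_subset component_in
    by (simp add: supp_def)
  show ?thesis
  proof
    show "supp (g v) \<subseteq> perm g ` supp v"
    proof
      fix j assume j: "j \<in> supp (g v)"
      then have "j < n" by (simp add: supp_def)
      then obtain i where "i < n" "j = perm g i"
        using permutes_image[OF perm_permutes[OF assms(1)]] by auto
      then show "j \<in> perm g ` supp v" using iff j by auto
    qed
    show "perm g ` supp v \<subseteq> supp (g v)" using iff by (auto simp: supp_def)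
  qed
qed

lemma card_orbit_vec:
  assumes "v \<in> vecs p d"
  shows "card (orbit_vec G v) * card {g \<in> G. g v = v} = card G"
  using card_orbit_times_stabilizer[of "\<lambda>g v. g v" v] finite_G assms
  by (simp add: orbit_vec_def vecs.act_mult[simplified] vecs.act_one[simplified])

lemma is_perm_group_induced: "is_perm_group n (induced_group n Vs G)"
proof -
  have "\<one>\<^bsub>BijGroup (vecs p d)\<^esub> \<in> G" using one_closed by simp
  moreover have "perm g \<circ> perm h \<in> perm ` G" if "g \<in> G" "h \<in> G" for g h
    using perm_mult[OF that] m_closed[of g h] that by force
  moreover have "Hilbert_Choice.inv (perm g) \<in> perm ` G" if "g \<in> G" for g
    using inv_unique_comp[OF perm_inv[OF that]] inv_closed_G[OF that] by simp
  ultimately show ?thesis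
    using perm_permutes by (auto simp: is_perm_group_def induced_group_def)
qed

end

section \<open>Exceptional groups\<close>

locale exceptional_sum = permuted_sum +
  assumes irreducible: "irreducible_lin p d G"
    and exceptional: "p_exceptional p d G"
    and O_p'_G: "O_p' p d G = G"
    and n_gt_1: "n > 1"
begin

text \<open>\<open>G\<close> equals the intersection of all such subgroups, so it is contained in
  each of them.\<close>

lemma no_p'_quotient:
  assumes "normal N (grp p d G)" "coprime p (order (grp p d G) div card N)"
  shows "N = G"
proof
  show "N \<subseteq> G" using subgroup.subset[OF normal_imp_subgroup[OF assms(1)]] by simp
  have "O_p' p d G \<subseteq> N" unfolding O_p'_def using assms by (intro Inter_lower) (simp add: order_def)
  then show "G \<subseteq> N" using O_p'_G by simp
qed

lemma coprime_orbit: "v \<in> vecs p d \<Longrightarrow> coprime p (card (orbit_vec G v))"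
  using exceptional by (simp add: p_exceptional_def)

text \<open>The index of the stabiliser is the orbit size, which exceptionality keeps coprime to
  \<open>p\<close>. The form is chosen to contradict \<open>ex_p_divisible_flag\<close>.\<close>

lemma not_p_card_stabilizer_dvd:
  assumes "v \<in> vecs p d"
  shows "\<not> p * card {g \<in> G. g v = v} dvd card G"
proof
  assume "p * card {g \<in> G. g v = v} dvd card G"
  moreover have "card {g \<in> G. g v = v} > 0"
    using finite_G subgroup.one_closed[OF vecs.subgroup_stabilizer[OF assms]]
    by (auto simp: card_gt_0_iff)
  ultimately have "p dvd card (orbit_vec G v)"
    unfolding card_orbit_vec[OF assms, symmetric] by simp
  then have "is_unit p" by (rule coprime_common_divisor[OF coprime_orbit[OF assms] dvd_refl])
  then show False using p_gt_1 by simp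
qed

text \<open>The flag of a Sylow subgroup cannot be read off equivariantly from a vector.\<close>
lemma ex_unreadable_flag:
  assumes "set_action (grp p d G) S act" and "g0 \<in> G" "s0 \<in> S" "act g0 s0 \<noteq> s0"
  shows "\<exists>s Q. Q \<subseteq> S \<and> s \<in> Q \<and>
    (\<forall>v\<in>vecs p d. \<exists>g\<in>G. g v = v \<and> \<not> (act g ` Q = Q \<and> act g s = s))"
proof -
  interpret set_action "grp p d G" S act by fact
  obtain s Q where sQ: "Q \<subseteq> S" "s \<in> Q"
    and flag: "\<forall>K. subgroup K (grp p d G) \<longrightarrow> (\<forall>k\<in>K. act k ` Q = Q \<and> act k s = s) \<longrightarrow>
      p * card K dvd order (grp p d G)"
    using ex_p_divisible_flag[of p g0 s0] prime_p no_p'_quotient finite_G assms(2-4) by auto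
  have "\<exists>g\<in>G. g v = v \<and> \<not> (act g ` Q = Q \<and> act g s = s)" if v: "v \<in> vecs p d" for v
  proof (rule ccontr)
    \<comment> \<open>The stabiliser of \<open>v\<close> would then fix both \<open>Q\<close> and
      \<open>s\<close>, so it could be taken for the subgroup \<open>K\<close> in
      \<open>flag\<close>.\<close>
    assume "\<not> ?thesis"
    then have "p * card {g \<in> G. g v = v} dvd card G"
      using spec[OF flag, of "{g \<in> G. g v = v}"] vecs.subgroup_stabilizer[OF v] by (simp add: order_def)
    then show False using not_p_card_stabilizer_dvd[OF v] by simp
  qed
  then show ?thesis using sQ by (intro exI[of _ s] exI[of _ Q]) simp
qed

section \<open>Transitivity on the summands\<close>

text \<open>The vectors supported on the orbit of index 0 form a nonzero invariant subspace. By
  irreducibility this is the whole space, so the orbit contains every index.\<close>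

lemma transitive_from_0:
  assumes "j < n"
  shows "\<exists>g\<in>G. perm g 0 = j"
proof -
  let ?O = "(\<lambda>g. perm g 0) ` G"
  let ?W = "{v \<in> vecs p d. supp v \<subseteq> ?O}"
  have n0: "0 < n" using n_gt_1 by simp
  have "g ` ?W \<subseteq> ?W" if g: "g \<in> G" for g
  proof -
    have "perm g (perm h 0) \<in> ?O" if h: "h \<in> G" for h
      using idx.act_mult[of g h 0] m_closed[of g h] g h n0 by (auto intro!: image_eqI)
    then have "perm g ` ?O \<subseteq> ?O" by auto
    then have "supp (g v) \<subseteq> ?O" if "v \<in> vecs p d" "supp v \<subseteq> ?O" for v
      unfolding supp_apply[OF g that(1)]
      using image_mono[OF that(2), of "perm g"] by (rule subset_trans[rotated])
    then show ?thesis using maps_vecs[OF g] by (simp add: image_subset_iff)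
  qed
  then have W: "?W = {vzero} \<or> ?W = vecs p d"
    using spec[OF irreducible[unfolded irreducible_lin_def], of ?W] subspace_supp by simp
  have "0 \<in> ?O"
    using perm_one one_closed by (auto intro!: image_eqI[where x = "\<one>\<^bsub>BijGroup (vecs p d)\<^esub>"])
  then have "pick 0 \<in> ?W" "pick 0 \<noteq> vzero"
    using pick[OF n0] supp_summand[OF n0] summand_subset[OF n0] by auto
  with W have "?W = vecs p d" by blast
  moreover have "pick j \<in> vecs p d" "supp (pick j) = {j}"
    using pick[OF assms] supp_summand[OF assms] summand_subset[OF assms] by auto
  ultimately have "j \<in> ?O" by blast
  then show ?thesis by blast
qed

lemma transitive:
  assumes "i < n" "j < n"
  shows "\<exists>g\<in>G. perm g i = j"
proof -
  obtain h k where hk: "h \<in> G" "perm h 0 = i" "k \<in> G" "perm k 0 = j"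
    using transitive_from_0 assms by blast
  let ?h' = "inv\<^bsub>grp p d G\<^esub> h"
  have "perm ?h' i = 0" using fun_cong[OF perm_inv(2)[OF hk(1)], of 0] hk by simp
  then have "perm (k \<otimes>\<^bsub>BijGroup (vecs p d)\<^esub> ?h') i = j"
    using hk perm_mult[OF hk(3) inv_closed_G[OF hk(1)]] by simp
  moreover have "k \<otimes>\<^bsub>BijGroup (vecs p d)\<^esub> ?h' \<in> G"
    using m_closed[of k ?h'] hk inv_closed_G by simp
  ultimately show ?thesis by blast
qed

lemma ex_moved_index: "\<exists>g\<in>G. perm g 0 \<noteq> 0"
proof -
  obtain g where "g \<in> G" "perm g 0 = 1" using transitive[of 0 1] n_gt_1 by auto
  then show ?thesis by (intro bexI[of _ g]) auto
qed

section \<open>Transitivity on the nonzero vectors of one summand\<close>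

text \<open>A conjugate of \<open>u\<close> marks the index \<open>s\<close> among conjugates of
  \<open>w\<close>. An element fixing such a vector preserves \<open>Q\<close>, and moving
  \<open>s\<close> would make \<open>u\<close> and \<open>w\<close> conjugate.\<close>

lemma transitive_on_summand:
  assumes u: "u \<in> Vs 0" "u \<noteq> vzero" and w: "w \<in> Vs 0" "w \<noteq> vzero"
  shows "\<exists>g\<in>G. g u = w"
proof (rule ccontr)
  assume nonconj: "\<not> (\<exists>g\<in>G. g u = w)"
  have n0: "0 < n" using n_gt_1 by simp
  obtain g0 where g0: "g0 \<in> G" "perm g0 0 \<noteq> 0" using ex_moved_index by blast
  obtain s Q where sQ: "Q \<subseteq> {..<n}" "s \<in> Q"
    and flag: "\<forall>v\<in>vecs p d. \<exists>g\<in>G. g v = v \<and> \<not> (perm g ` Q = Q \<and> perm g s = s)"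
    using ex_unreadable_flag[of _ perm, OF idx.set_action_axioms g0(1) lessThan_iff[THEN iffD2, OF n0] g0(2)]
    by (elim exE conjE) (rule that)
  have "\<forall>i. \<exists>g. i < n \<longrightarrow> g \<in> G \<and> perm g 0 = i" using transitive[OF n0] by blast
  \<comment> \<open>The elements \<open>h i\<close> transport \<open>u\<close> and \<open>w\<close>
    from the summand of index 0 to the summand of index \<open>i\<close>.\<close>
  then obtain h where h: "\<And>i. i < n \<Longrightarrow> h i \<in> G" "\<And>i. i < n \<Longrightarrow> perm (h i) 0 = i"
    by metis
  define c where "c i = (if i = s then h i u else if i \<in> Q then h i w else vzero)" for i
  have h_in: "h i x \<in> Vs i" "h i x \<noteq> vzero" if "i < n" "x \<in> Vs 0" "x \<noteq> vzero" for i x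
  proof -
    show "h i x \<in> Vs i" using image_summand[OF h(1)[OF that(1)] n0] h(2) that by auto
    show "h i x \<noteq> vzero"
      using apply_eq_vzero_iff[OF h(1)[OF that(1)] summand_subset[OF n0 that(2)]] that by simp
  qed
  have c_in: "c i \<in> Vs i" if "i < n" for i
    using that h_in u w by (simp add: c_def vzero_in_summand)
  define v where "v = vsum p n c"
  have v: "v \<in> vecs p d" unfolding v_def using c_in by (rule vsum_summands_in_vecs)
  have comp_v: "component v i = c i" if "i < n" for i
    unfolding v_def using c_in that by (rule component_vsum)
  have supp_v: "supp v = Q"
    unfolding v_def using sQ h_in u w by (subst supp_vsum[OF c_in]) (auto simp: c_def)
  obtain g where g: "g \<in> G" "g v = v" "\<not> (perm g ` Q = Q \<and> perm g s = s)" using bspec[OF flag v] by blast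
  \<comment> \<open>As the support of a fixed vector, \<open>Q\<close> is preserved; by the choice
    of \<open>g\<close> it is therefore \<open>s\<close> that moves.\<close>
  have gQ: "perm g ` Q = Q" using supp_apply[OF g(1) v] g(2) supp_v by simp
  define t where "t = perm g s"
  have t: "t \<noteq> s" "t \<in> Q" "t < n" "s < n" using g gQ sQ t_def by auto
  have "h t w = component v t" using comp_v t by (simp add: c_def)
  also have "\<dots> = g (component v s)" using component_perm[OF g(1) v t(4)] g(2) t_def by simp
  also have "\<dots> = g (h s u)" using comp_v t by (simp add: c_def)
  finally have eq: "h t w = g (h s u)" .
  let ?k = "inv\<^bsub>grp p d G\<^esub> h t"
  have uv: "u \<in> vecs p d" "w \<in> vecs p d" using u w summand_subset[OF n0] by auto
  have ht: "h t \<in> G" "h s \<in> G" "?k \<in> G" using h t inv_closed_G by auto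
  \<comment> \<open>Cancelling \<open>h t\<close> in \<open>eq\<close> exhibits \<open>w\<close> as
    the image of \<open>u\<close> under an element of \<open>G\<close>.\<close>
  have "w = ?k (h t w)" using vecs.act_inv_cancel[of "h t" w] ht uv by simp
  also have "\<dots> = (?k \<otimes>\<^bsub>BijGroup (vecs p d)\<^esub> (g \<otimes>\<^bsub>BijGroup (vecs p d)\<^esub> h s)) u"
    unfolding eq using ht g uv m_closed[of g "h s"] by (simp add: mult_apply maps_vecs)
  finally show False
    using nonconj m_closed[of ?k "g \<otimes>\<^bsub>BijGroup (vecs p d)\<^esub> h s"] m_closed[of g "h s"] ht g by auto
qed

text \<open>An element taking \<open>u\<close> to \<open>w\<close> preserves \<open>Vs 0\<close>,
  since it sends a nonzero vector of that summand into it.\<close>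

lemma transitive_summand_stabilizer:
  assumes "u \<in> Vs 0 - {vzero}" "w \<in> Vs 0 - {vzero}"
  shows "\<exists>g\<in>G. g ` Vs 0 = Vs 0 \<and> g u = w"
proof -
  have n0: "0 < n" using n_gt_1 by simp
  obtain g where g: "g \<in> G" "g u = w" using transitive_on_summand assms by blast
  then have "perm g 0 = 0" using perm_eqI_vector[OF g(1) n0 n0, of u] assms by simp
  then show ?thesis using g image_summand[OF g(1) n0] by auto
qed

section \<open>Primitivity of the induced group\<close>

text \<open>A set \<open>A\<close> of indices is built from which \<open>Q\<close> and
  \<open>s\<close> can both be recovered, so the vector \<open>support_vec A\<close> contradicts
  \<open>ex_unreadable_flag\<close>.\<close>

lemma block_trivial:
  assumes B: "B \<subseteq> {..<n}" "B \<noteq> {}"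
    and block: "\<And>g. g \<in> G \<Longrightarrow> perm g ` B = B \<or> perm g ` B \<inter> B = {}"
  shows "card B = 1 \<or> B = {..<n}"
proof (rule ccontr)
  assume neg: "\<not> ?thesis"
  obtain b c where bc: "b \<in> B" "c < n" "c \<notin> B" using neg B by blast
  obtain g0 where g0: "g0 \<in> G" "perm g0 b = c" using transitive bc B by blast
  \<comment> \<open>The action on the translates of \<open>B\<close> is therefore not
    trivial.\<close>
  then have g0B: "perm g0 ` B \<noteq> B" using bc by blast
  define S where "S = (\<lambda>g. perm g ` B) ` G"
  have S_sub: "C \<subseteq> {..<n}" if "C \<in> S" for C
    using that B perm_less by (auto simp: S_def)
  have mult_in: "perm g ` C \<in> S" if gC: "g \<in> G" "C \<in> S" for g C
  proof -
    obtain h where h: "h \<in> G" "C = perm h ` B" using gC by (auto simp: S_def)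
    then have "perm g ` C = perm (g \<otimes>\<^bsub>BijGroup (vecs p d)\<^esub> h) ` B"
      using gC perm_mult[OF gC(1) h(1)] by (simp add: image_comp)
    then show ?thesis unfolding S_def using m_closed[of g h] gC h by simp
  qed
  have action: "set_action (grp p d G) S (\<lambda>g. image (perm g))"
  proof unfold_locales
    show "perm g ` C \<in> S" if "g \<in> carrier (grp p d G)" "C \<in> S" for g C using that mult_in by simp
    show "perm (g \<otimes>\<^bsub>grp p d G\<^esub> h) ` C = perm g ` perm h ` C"
      if "g \<in> carrier (grp p d G)" "h \<in> carrier (grp p d G)" "C \<in> S" for g h C
      using that perm_mult[of g h] by (simp add: image_comp)
    show "perm \<one>\<^bsub>grp p d G\<^esub> ` C = C" if "C \<in> S" for C using perm_one by simp
  qed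
  have BS: "B \<in> S"
    unfolding S_def using perm_one one_closed
    by (intro image_eqI[where x = "\<one>\<^bsub>BijGroup (vecs p d)\<^esub>"]) auto
  \<comment> \<open>Translating back by the inverse of \<open>g\<close> turns \<open>C\<close> into
    \<open>B\<close>, where the block property applies.\<close>
  have disj: "C = D" if CD: "C \<in> S" "D \<in> S" "x \<in> C" "x \<in> D" for C D x
  proof -
    obtain g h where gh: "g \<in> G" "C = perm g ` B" "h \<in> G" "D = perm h ` B"
      using CD(1,2) by (auto simp: S_def)
    let ?g' = "inv\<^bsub>grp p d G\<^esub> g"
    have g'G: "?g' \<in> G" using gh inv_closed_G by simp
    define k where "k = ?g' \<otimes>\<^bsub>BijGroup (vecs p d)\<^esub> h"
    have k: "k \<in> G" unfolding k_def using m_closed[of ?g' h] g'G gh by simp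
    have pk: "perm k ` B = perm ?g' ` D"
      unfolding k_def gh(4) using perm_mult[OF g'G gh(3)] by (simp add: image_comp)
    have C': "perm ?g' ` C = B" unfolding gh(2) using perm_inv(2)[OF gh(1)] by (simp add: image_comp)
    have "perm ?g' x \<in> perm k ` B \<inter> B" using pk C' CD(3,4) by blast
    then have "perm k ` B = B" using block[OF k] by blast
    then have "perm g ` perm ?g' ` D = perm g ` B" using pk by simp
    moreover have "perm g (perm ?g' x) = x" for x
      using fun_cong[OF perm_inv(1)[OF gh(1)], of x] by simp
    ultimately show ?thesis using gh(2) by (simp add: image_image)
  qed
  obtain s Q where sQ: "Q \<subseteq> S" "s \<in> Q"
    and flag: "\<forall>v\<in>vecs p d. \<exists>g\<in>G. g v = v \<and> \<not> (image (perm g) ` Q = Q \<and> perm g ` s = s)"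
    using ex_unreadable_flag[of _ "\<lambda>g. image (perm g)", OF action g0(1) BS g0B] by (elim exE conjE) (rule that)
  have card_S: "card C = card B" "C \<noteq> {}" if "C \<in> S" for C
    using that B bij_perm by (auto simp: S_def card_image bij_def inj_on_def)
  define a where "a C = (SOME x. x \<in> C)" for C :: "nat set"
  have a: "a C \<in> C" if "C \<in> S" for C
    unfolding a_def using card_S(2)[OF that] by (simp add: some_in_eq)
  \<comment> \<open>\<open>Q\<close> will be recovered as the set of translates meeting
    \<open>A\<close>, and \<open>s\<close> as the only member of \<open>Q\<close> contained in
    \<open>A\<close>.\<close>
  define A where "A = s \<union> a ` (Q - {s})"
  have AQ: "C \<inter> A \<noteq> {}" if "C \<in> Q" for C
  proof -
    have "a C \<in> C" using a that sQ by blast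
    then have "a C \<in> C \<inter> A" using that by (cases "C = s") (auto simp: A_def)
    then show ?thesis by blast
  qed
  have QA: "C \<in> Q" if C: "C \<in> S" "C \<inter> A \<noteq> {}" for C
  proof -
    obtain x where x: "x \<in> C" "x \<in> A" using C by blast
    then obtain D where "D \<in> Q" "x \<in> D" unfolding A_def using sQ a by blast
    then show ?thesis using disj[OF C(1), of D x] x sQ by auto
  qed
  \<comment> \<open>Another block of \<open>Q\<close> is disjoint from \<open>s\<close> and meets
    \<open>A\<close> only in its representative. Inside \<open>A\<close> it would be a singleton,
    but every translate has the size of \<open>B\<close>, which is not 1.\<close>
  have only_s: "C = s" if C: "C \<in> Q" "C \<subseteq> A" for C
  proof (rule ccontr)
    assume ne: "C \<noteq> s"
    have "x = a C" if x: "x \<in> C" for x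
    proof -
      have "x \<notin> s" using disj[of C s x] x ne C sQ by auto
      then obtain D where D: "D \<in> Q" "x = a D" using x C unfolding A_def by blast
      then have "x \<in> D" using a sQ by blast
      then have "C = D" using disj[of C D x] x C D sQ by auto
      then show ?thesis using D by simp
    qed
    then have "C = {a C}" using a C sQ by blast
    then have "card C = 1" by (metis card_1_singleton_iff One_nat_def)
    then show False using card_S(1) C sQ neg by auto
  qed
  have A_sub: "A \<subseteq> {..<n}" unfolding A_def using S_sub a sQ by blast
  obtain g where g: "g \<in> G" "g (support_vec A) = support_vec A"
    "\<not> (image (perm g) ` Q = Q \<and> perm g ` s = s)"
    using bspec[OF flag support_vec(1)[OF A_sub]] by blast
  have gA: "perm g ` A = A"
    using supp_apply[OF g(1) support_vec(1)[OF A_sub]] g(2) support_vec(2)[OF A_sub] by simp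
  have "perm g ` C \<in> Q" if "C \<in> Q" for C
  proof (rule QA)
    show "perm g ` C \<in> S" using mult_in[OF g(1)] that sQ by blast
    show "perm g ` C \<inter> A \<noteq> {}" using AQ[OF that] gA by blast
  qed
  moreover have "finite Q"
    by (rule finite_subset[of _ "Pow {..<n}"]) (use sQ S_sub in auto)
  moreover have "inj_on (image (perm g)) Q"
    using bij_perm[OF g(1)] by (auto simp: inj_on_def bij_def inj_image_eq_iff)
  ultimately have gQ: "image (perm g) ` Q = Q" by (intro endo_inj_surj) auto
  moreover have "perm g ` s = s"
  proof (rule only_s)
    show "perm g ` s \<in> Q" using gQ sQ by blast
    have "perm g ` s \<subseteq> perm g ` A" unfolding A_def by blast
    then show "perm g ` s \<subseteq> A" using gA by simp
  qed
  ultimately show False using g(3) by blast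
qed

lemma primitive_induced: "primitive_perm n (induced_group n Vs G)"
proof -
  have "\<exists>\<sigma>\<in>perm ` G. \<sigma> i = j" if "i < n" "j < n" for i j
    using transitive[OF that] by simp
  moreover have "card B = 1 \<or> B = {..<n}"
    if "B \<subseteq> {..<n}" "B \<noteq> {}" "\<forall>\<sigma>\<in>perm ` G. \<sigma> ` B = B \<or> \<sigma> ` B \<inter> B = {}" for B
    using that(1,2) by (rule block_trivial) (use that(3) in simp)
  ultimately show ?thesis unfolding primitive_perm_def induced_group_def by simp
qed

section \<open>Concealment of the induced group\<close>

text \<open>Otherwise the kernel of the action on indices has index coprime to \<open>p\<close>, so
  it is all of \<open>G\<close>, although some element moves index 0.\<close>

lemma p_dvd_card_induced: "p dvd card (induced_group n Vs G)"
proof (rule ccontr)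
  assume "\<not> p dvd card (induced_group n Vs G)"
  then have cop: "coprime p (card (induced_group n Vs G))"
    using prime_p prime_imp_coprime by blast
  define N where "N = {g \<in> G. \<forall>i\<in>{..<n}. perm g i = i}"
  have N: "normal N (grp p d G)" using idx.normal_kernel unfolding N_def by simp
  have N_eq: "N = {g \<in> G. perm g \<circ> id = id}"
    unfolding N_def using perm_ge by (force simp: fun_eq_iff)
  \<comment> \<open>Composition makes \<open>G\<close> act on functions. The orbit of
    \<open>id\<close> is the induced group and its stabiliser is the kernel
    \<open>N\<close>.\<close>
  have "card ((\<lambda>g. perm g \<circ> id) ` G) * card {g \<in> G. perm g \<circ> id = id} = card G"
    using card_orbit_times_stabilizer[of "\<lambda>g f. perm g \<circ> f" id] finite_G perm_mult perm_one
    by simp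
  then have card: "card (induced_group n Vs G) * card N = card G"
    unfolding N_eq by (simp add: induced_group_def)
  have "card G > 0" using finite_G one_closed by (auto simp: card_gt_0_iff)
  then have "card N > 0" using card by (metis mult_0_right not_gr_zero)
  then have "order (grp p d G) div card N = card (induced_group n Vs G)"
    using card by (simp add: order_def flip: card)
  then have "N = G" using no_p'_quotient[OF N] cop by simp
  moreover obtain g where "g \<in> G" "perm g 0 \<noteq> 0" using ex_moved_index by blast
  ultimately have "\<forall>i\<in>{..<n}. perm g i = i" unfolding N_def by blast
  then show False using \<open>perm g 0 \<noteq> 0\<close> n_gt_1 by auto
qed

text \<open>The stabiliser of \<open>support_vec A\<close> lies in that of \<open>A\<close>, so the
  orbit size of \<open>A\<close> divides the size of a vector orbit, which is coprime to
  \<open>p\<close>.\<close>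

lemma concealed_induced: "p_concealed p n (induced_group n Vs G)"
proof -
  have "coprime p (card ((\<lambda>\<sigma>. \<sigma> ` A) ` induced_group n Vs G))" if A: "A \<subseteq> {..<n}" for A
  proof -
    let ?v = "support_vec A"
    have v: "?v \<in> vecs p d" "supp ?v = A" using support_vec[OF A] by auto
    let ?KA = "{g \<in> G. perm g ` A = A}" and ?Kv = "{g \<in> G. g ?v = ?v}"
    have "card ((\<lambda>g. perm g ` A) ` G) * card ?KA = card G"
      using card_orbit_times_stabilizer[of "\<lambda>g. image (perm g)" A] finite_G perm_mult perm_one
      by (simp add: image_comp)
    then have orbits: "card ((\<lambda>g. perm g ` A) ` G) * card ?KA = card (orbit_vec G ?v) * card ?Kv"
      using card_orbit_vec[OF v(1)] by simp
    have "perm g ` A = A" if "g \<in> G" "g ?v = ?v" for g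
      using supp_apply[OF that(1) v(1)] that(2) v(2) by simp
    then have "?Kv \<subseteq> ?KA" by blast
    then have "card ?Kv dvd card ?KA"
      using card_subgroup_dvd[of ?Kv ?KA] finite_G vecs.subgroup_stabilizer[OF v(1)]
        subsets.subgroup_stabilizer[of A] A by simp
    then obtain r where r: "card ?KA = card ?Kv * r" by (elim dvdE)
    have "card ?Kv > 0"
      using finite_G subgroup.one_closed[OF vecs.subgroup_stabilizer[OF v(1)]]
      by (auto simp: card_gt_0_iff)
    then have "card ((\<lambda>g. perm g ` A) ` G) * r = card (orbit_vec G ?v)" using orbits r by simp
    then have "card ((\<lambda>g. perm g ` A) ` G) dvd card (orbit_vec G ?v)" by (metis dvd_triv_left)
    then have "coprime p (card ((\<lambda>g. perm g ` A) ` G))"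
      using coprime_orbit[OF v(1)] coprime_divisors dvd_refl by blast
    then show ?thesis by (simp add: induced_group_def image_image)
  qed
  then show ?thesis using p_dvd_card_induced by (simp add: p_concealed_def)
qed

end

theorem theorem1p3:
  fixes p d n :: nat
    and G :: "((nat \<Rightarrow> nat) \<Rightarrow> (nat \<Rightarrow> nat)) set"
    and Vs :: "nat \<Rightarrow> (nat \<Rightarrow> nat) set"
  assumes "Factorial_Ring.prime p"
    and "subgroup G (BijGroup (vecs p d))"
    and "G \<subseteq> GL p d"
    and "irreducible_lin p d G"
    and "p_exceptional p d G"
    and "imprimitive_lin p d G"
    and "O_p' p d G = G"
    and "n > 1"
    and "direct_decomp p d n Vs"
    and "permutes_decomp G n Vs"
  shows "(\<forall>u\<in>Vs 0 - {vzero}. \<forall>w\<in>Vs 0 - {vzero}. \<exists>g\<in>G. g ` Vs 0 = Vs 0 \<and> g u = w)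
    \<and> is_perm_group n (induced_group n Vs G)
    \<and> primitive_perm n (induced_group n Vs G)
    \<and> p_concealed p n (induced_group n Vs G)"
proof -
  interpret exceptional_sum p d n Vs G
    using assms
    by (intro exceptional_sum.intro permuted_sum.intro direct_sum.intro
        permuted_sum_axioms.intro exceptional_sum_axioms.intro)
  show ?thesis
    by (intro conjI ballI transitive_summand_stabilizer is_perm_group_induced primitive_induced
        concealed_induced)
qed

end
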